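(* Let $\mu\in\mathbb{R}$ with $\mu<1/2$ and let $\sigma>0$. Then there exists a real constant $m\in(0,1)$, namely $$m=\frac{1+l-\sqrt{1+l^{2}}}{2},\qquad l=\frac{2\sigma^{2}}{1-2\mu},$$ with the following properties. For each sufficiently large positive integer $n$ put $\lambda=\lambda_n=m/n$ (so that $n\lambda=m$ for all $n$, and $\lambda\to 0$ as $n\to+\infty$), and for $x\in(0,1)$ define $$f_{1}(x)=\mathrm{KL}\big(\mathcal{N}(x,x(1-x))\,\|\,\mathcal{N}(\mu,\sigma^{2})\big),$$ $$f_{2,n}(x)=\mathrm{KL}\big(\mathcal{N}(x,x(1-x))\,\|\,\mathcal{N}(n\lambda,n\lambda(1-\lambda))\big),$$ $$f_{2,n}^{*}=\min_{x\in(0,1)}f_{2,n}(x).$$ Then: (i) $f_{1}$ attains its minimum over the interval $(0,1)$ at $x=m$; (ii) in the limit $n\to+\infty$, $\lambda\to0$ with $n\lambda=m$ fixed, the gap $f_{2,n}(x)-f_{2,n}^{*}$ at $x=m$ lies in the interval $\left(0,\tfrac{\sqrt{2}}{2}-\tfrac12\right)$, i.e. $$0<\lim_{n\to+\infty}\big[f_{2,n}(m)-f_{2,n}^{*}\big]<\frac{\sqrt{2}}{2}-\frac{1}{2}.$$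
   Context: $\mathcal{N}(a,b)$ denotes the one-dimensional Gaussian distribution with mean $a$ and variance $b>0$. $\mathrm{KL}(P\|Q)=\int p\log(p/q)$ denotes the Kullback–Leibler divergence (natural logarithm) between distributions with densities $p,q$. The Gaussian $\mathcal{N}(n\lambda,n\lambda(1-\lambda))$ is the De Moivre–Laplace Gaussian approximation of the Binomial distribution $\mathcal{B}(n,\lambda)$ with $n$ trials and success probability $\lambda$; the regime considered is $n\to+\infty$, $\lambda\to0$ with $n\lambda=m$ held constant. *)

theory Defs
  imports "HOL-Probability.Probability"
begin

text \<open>The second argument is the variance, whereas \<^const>\<open>normal_density\<close> takes the
  standard deviation.\<close>

definition gaussian :: "real \<Rightarrow> real \<Rightarrow> real measure" where
  "gaussian a b = density lborel (\<lambda>x. ennreal (normal_density a (sqrt b) x))"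

text \<open>\<^term>\<open>KL_divergence b M N\<close> integrates with respect to its last argument, so that the
  arguments are swapped here; the base \<^term>\<open>exp 1\<close> makes the logarithm natural.\<close>

definition KL :: "real measure \<Rightarrow> real measure \<Rightarrow> real" where
  "KL P Q = KL_divergence (exp 1) Q P"

lemma KL_gaussian_eq_integral:
  assumes "b > 0" "d > 0"
  shows "KL (gaussian a b) (gaussian c d) =
    (\<integral>x. normal_density a (sqrt b) x *
        ln (normal_density a (sqrt b) x / normal_density c (sqrt d) x) \<partial>lborel)"
proof -
  have pos: "normal_density c (sqrt d) x > 0" for x
    using assms by (simp add: normal_density_pos)
  have "KL_divergence (exp 1) (gaussian c d) (gaussian a b) =
    (\<integral>x. normal_density a (sqrt b) x *
        log (exp 1) (normal_density a (sqrt b) x / normal_density c (sqrt d) x) \<partial>lborel)"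
    unfolding gaussian_def
    by (rule lborel.KL_density_density) (auto simp: less_imp_neq[OF pos, symmetric])
  then show ?thesis
    by (simp add: KL_def log_def)
qed

definition f1 :: "real \<Rightarrow> real \<Rightarrow> real \<Rightarrow> real" where
  "f1 \<mu> \<sigma> x = KL (gaussian x (x * (1 - x))) (gaussian \<mu> (\<sigma>\<^sup>2))"

definition f2 :: "nat \<Rightarrow> real \<Rightarrow> real \<Rightarrow> real" where
  "f2 n lam x = KL (gaussian x (x * (1 - x)))
     (gaussian (real n * lam) (real n * lam * (1 - lam)))"

text \<open>An infimum of reals is only meaningful when the set is bounded below; that it is an attained
  minimum is part of the theorem.\<close>

definition f2_min :: "nat \<Rightarrow> real \<Rightarrow> real" where
  "f2_min n lam = (INF x\<in>{0<..<1}. f2 n lam x)"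

end

theory Submission
  imports Defs
begin

text \<open>As a function of \<^term>\<open>x\<close>, the divergence of the Gaussian of mean \<^term>\<open>x\<close> and variance
  \<^term>\<open>x * (1 - x)\<close> from that of mean \<open>\<mu>\<close> and variance \<^term>\<open>v\<close> is, up to a constant,
  \<open>- ln (x (1 - x)) / 2 + x / l\<close> with \<open>l = 2 v / (1 - 2 \<mu>)\<close>. This is strictly convex, and its
  stationary point is the root \<open>(1 + l - sqrt (1 + l\<^sup>2)) / 2\<close> of a quadratic equation. Both parts
  are instances: \<open>f1\<close> has \<open>v = \<sigma>\<^sup>2\<close>, and \<open>f2\<close> has \<open>\<mu> = m\<close> and \<open>v = m (1 - m / n)\<close>, so its minimiser
  tends to the stationary point \<open>y\<close> for \<open>k = 2 m / (1 - 2 m)\<close>. The limiting gap is positive since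
  \<open>y\<close> differs from \<open>m\<close>, and the tangent at \<open>m\<close> bounds it by \<open>(y - m) (1 - 2 m) / (2 (1 - m))\<close>.
  Using \<open>y < k / 2\<close> for \<open>m \<le> 1 / 4\<close> and \<open>y < 1 / 2\<close> otherwise, this is at most \<open>1 / 12\<close>.\<close>

text \<open>The logarithm of the ratio of the densities is a quadratic polynomial in
  \<open>x - a\<close>, so the integral needs only the moments of orders 0, 1 and 2 of the first
  Gaussian about its mean.\<close>

lemma KL_gaussian:
  assumes b: "b > 0" and d: "d > 0"
  shows "KL (gaussian a b) (gaussian c d) = (ln d - ln b + (b + (a - c)\<^sup>2) / d - 1) / 2"
proof -
  let ?N = "normal_density a (sqrt b)"
  let ?s = "(ln d - ln b) / 2 + (a - c)\<^sup>2 / (2 * d)"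
  have sb: "sqrt b > 0"
    using b by simp
  have ln_normal_density: "ln (normal_density e (sqrt v) x) = - ln (2 * pi * v) / 2 - (x - e)\<^sup>2 / (2 * v)"
    if "v > 0" for e v x :: real
    using that by (simp add: normal_density_def ln_mult ln_div ln_sqrt add_divide_distrib)
  have log_ratio: "ln (?N x / normal_density c (sqrt d) x) =
      ?s + (x - a) * ((a - c) / d) + (x - a)\<^sup>2 * (1 / (2 * d) - 1 / (2 * b))" for x
  proof -
    have "ln (?N x / normal_density c (sqrt d) x) =
        (ln (2 * pi * d) - ln (2 * pi * b)) / 2 + ((x - c)\<^sup>2 / (2 * d) - (x - a)\<^sup>2 / (2 * b))"
      using b d by (subst ln_div)
        (auto simp: normal_density_pos ln_normal_density less_imp_neq[symmetric] diff_divide_distrib)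
    also have "(x - c)\<^sup>2 / (2 * d) - (x - a)\<^sup>2 / (2 * b) =
        (a - c)\<^sup>2 / (2 * d) + (x - a) * ((a - c) / d) + (x - a)\<^sup>2 * (1 / (2 * d) - 1 / (2 * b))"
      using b d by (simp add: field_simps power2_eq_square)
    finally show ?thesis
      using b d by (simp add: ln_mult algebra_simps)
  qed
  have m0: "has_bochner_integral lborel ?N 1"
    using normal_moment_even[OF sb, of a 0] by simp
  have m1: "has_bochner_integral lborel (\<lambda>x. ?N x * (x - a)) 0"
    using normal_moment_odd[OF sb, of a 0] by simp
  have m2: "has_bochner_integral lborel (\<lambda>x. ?N x * (x - a)\<^sup>2) b"
    using normal_moment_even[OF sb, of a 1] b by simp
  have "has_bochner_integral lborel
      (\<lambda>x. ?N x * ?s + ?N x * (x - a) * ((a - c) / d) + ?N x * (x - a)\<^sup>2 * (1 / (2 * d) - 1 / (2 * b)))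
      (1 * ?s + 0 * ((a - c) / d) + b * (1 / (2 * d) - 1 / (2 * b)))"
    by (intro has_bochner_integral_add has_bochner_integral_mult_left m0 m1 m2)
  then have "has_bochner_integral lborel (\<lambda>x. ?N x * ln (?N x / normal_density c (sqrt d) x))
      (?s + b * (1 / (2 * d) - 1 / (2 * b)))"
    by (simp add: log_ratio distrib_left mult.assoc)
  then show ?thesis
    using b d unfolding KL_gaussian_eq_integral[OF b d]
    by (simp add: has_bochner_integral_integral_eq field_simps)
qed

definition argmin :: "real \<Rightarrow> real" where
  "argmin l = (1 + l - sqrt (1 + l\<^sup>2)) / 2"

lemma argmin_bounds:
  assumes "l > 0"
  shows "0 < argmin l" "argmin l < 1 / 2" "argmin l < l / 2"
proof -
  have "sqrt (1 + l\<^sup>2) < 1 + l"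
    using assms by (intro real_less_lsqrt) (auto simp: power2_eq_square algebra_simps)
  moreover have "l < sqrt (1 + l\<^sup>2)"
    by (intro real_less_rsqrt) auto
  moreover have "1 < sqrt (1 + l\<^sup>2)"
    using assms by simp
  ultimately show "0 < argmin l" "argmin l < 1 / 2" "argmin l < l / 2"
    by (auto simp: argmin_def)
qed

text \<open>The quadratic is \<open>x\<^sup>2 - (1 + l) * x + l / 2 = 0\<close>, whose completed
  square starts the proof; dividing it by \<open>l * x * (1 - x)\<close> turns it into the vanishing
  of the derivative.\<close>

lemma argmin_stationary:
  assumes "l > 0"
  shows "1 / argmin l - 1 / (1 - argmin l) = 2 / l"
proof -
  have "(2 * argmin l - (1 + l))\<^sup>2 = 1 + l\<^sup>2"
    by (simp add: argmin_def field_simps)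
  then have "l * (1 - 2 * argmin l) = 2 * argmin l * (1 - argmin l)"
    by (simp add: power2_eq_square algebra_simps)
  with argmin_bounds[OF assms] assms show ?thesis
    by (simp add: field_simps)
qed

text \<open>The divergence at \<open>x\<close> minus that at \<open>y\<close>, for a common second
  Gaussian. Quotients inside the logarithms make \<open>ln t \<le> t - 1\<close> applicable.\<close>

definition excess :: "real \<Rightarrow> real \<Rightarrow> real \<Rightarrow> real" where
  "excess l x y = (ln (y / x) + ln ((1 - y) / (1 - x))) / 2 + (x - y) / l"

lemma KL_gaussian_diff:
  assumes "\<mu> < 1 / 2" "v > 0" "l = 2 * v / (1 - 2 * \<mu>)" "x \<in> {0<..<1}" "y \<in> {0<..<1}"
  shows "KL (gaussian x (x * (1 - x))) (gaussian \<mu> v) -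
    KL (gaussian y (y * (1 - y))) (gaussian \<mu> v) = excess l x y"
proof -
  have KL_eq: "KL (gaussian z (z * (1 - z))) (gaussian \<mu> v) =
      (ln v - ln z - ln (1 - z) + \<mu>\<^sup>2 / v - 1) / 2 + z / l" if "z \<in> {0<..<1}" for z
  proof -
    have "z * (1 - z) > 0"
      using that by simp
    \<comment> \<open>The squares of \<open>z\<close> cancel, which leaves a term linear in
      \<open>z\<close> with slope \<open>(1 - 2 * \<mu>) / v = 2 / l\<close>.\<close>
    moreover have "(z * (1 - z) + (z - \<mu>)\<^sup>2) / v = \<mu>\<^sup>2 / v + 2 * (z / l)"
      using assms(2) by (simp add: assms(3) field_simps power2_eq_square)
    moreover have "ln (z * (1 - z)) = ln z + ln (1 - z)"
      using that by (simp add: ln_mult)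
    ultimately show ?thesis
      using assms(2) by (simp add: KL_gaussian add_divide_distrib diff_divide_distrib)
  qed
  moreover have "excess l x y = (ln y - ln x + (ln (1 - y) - ln (1 - x))) / 2 + (x - y) / l"
    using assms(4,5) by (simp add: excess_def ln_div)
  ultimately show ?thesis
    using assms(4,5) by (simp add: diff_divide_distrib add_divide_distrib)
qed

text \<open>Bounding both logarithms by \<open>ln t \<le> t - 1\<close> at \<open>x / y\<close> and
  \<open>(1 - x) / (1 - y)\<close>, with \<open>y\<close> the stationary point, gives a linear term
  that cancels \<open>(x - y) / l\<close> by stationarity. The first bound is strict because
  \<open>x\<close> differs from \<open>y\<close>.\<close>

lemma excess_argmin_pos:
  assumes "l > 0" "x \<in> {0<..<1}" "x \<noteq> argmin l"
  shows "excess l x (argmin l) > 0"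
proof -
  let ?y = "argmin l"
  have y: "0 < ?y" "?y < 1"
    using argmin_bounds[OF assms(1)] by auto
  have "ln (x / ?y) < x / ?y - 1"
    using assms y ln_le_minus_one[of "x / ?y"] ln_eq_minus_one[of "x / ?y"]
    by (force simp: field_simps)
  moreover have "ln ((1 - x) / (1 - ?y)) \<le> (1 - x) / (1 - ?y) - 1"
    using assms y by (intro ln_le_minus_one) auto
  moreover have "x / ?y - 1 + ((1 - x) / (1 - ?y) - 1) = (x - ?y) * (1 / ?y - 1 / (1 - ?y))"
    using y by (simp add: field_simps)
  moreover have "ln (x / ?y) = - ln (?y / x)" "ln ((1 - x) / (1 - ?y)) = - ln ((1 - ?y) / (1 - x))"
    using assms y by (auto simp: ln_div)
  ultimately show ?thesis
    using argmin_stationary[OF assms(1)] by (simp add: excess_def field_simps)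
qed

lemma KL_gaussian_argmin:
  assumes "\<mu> < 1 / 2" "v > 0" "l = 2 * v / (1 - 2 * \<mu>)" "x \<in> {0<..<1}"
  shows "KL (gaussian (argmin l) (argmin l * (1 - argmin l))) (gaussian \<mu> v)
    \<le> KL (gaussian x (x * (1 - x))) (gaussian \<mu> v)"
proof (cases "x = argmin l")
  case False
  have "l > 0"
    using assms by simp
  moreover from this have "argmin l \<in> {0<..<1}"
    using argmin_bounds[of l] by auto
  ultimately show ?thesis
    using KL_gaussian_diff[OF assms, of "argmin l"] excess_argmin_pos[of l x] False assms(4) by auto
qed simp

text \<open>By convexity the objective lies above its tangent at \<open>m\<close>; here
  \<open>ln t \<le> t - 1\<close> is used at the reciprocal quotients \<open>y / m\<close> and
  \<open>(1 - y) / (1 - m)\<close>.\<close>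

lemma excess_le:
  assumes "m \<in> {0<..<1}" "y \<in> {0<..<1}"
  shows "excess l m y \<le> (y - m) * (1 / m - 1 / (1 - m) - 2 / l) / 2"
proof -
  define p where "p = 1 / m - 1 / (1 - m)"
  have "ln (y / m) \<le> y / m - 1" "ln ((1 - y) / (1 - m)) \<le> (1 - y) / (1 - m) - 1"
    using assms by (auto intro!: ln_le_minus_one)
  moreover have "y / m - 1 + ((1 - y) / (1 - m) - 1) = (y - m) * p"
    using assms by (simp add: p_def field_simps)
  ultimately have "excess l m y \<le> (y - m) * p / 2 + (m - y) / l"
    by (simp add: excess_def)
  also have "\<dots> = (y - m) * (p - 2 / l) / 2"
    by (simp add: algebra_simps diff_divide_distrib)
  finally show ?thesis
    by (simp add: p_def)
qed

lemma excess_limit_bounds: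
  fixes m :: real
  defines "k \<equiv> 2 * m / (1 - 2 * m)"
  assumes m: "0 < m" "m < 1 / 2"
  shows "0 < excess k m (argmin k)" "excess k m (argmin k) < sqrt 2 / 2 - 1 / 2"
proof -
  have k: "k > 0" "2 / k = (1 - 2 * m) / m"
    using m by (simp_all add: k_def field_simps)
  let ?y = "argmin k"
  note y = argmin_bounds[OF k(1)]
  define s where "s = (1 - 2 * m) / (1 - m)"
  have s: "s > 0"
    using m by (simp add: s_def)
  have slope: "1 / m - 1 / (1 - m) - 2 / k = s"
    using m by (simp add: k(2) s_def divide_simps) (simp add: algebra_simps)
  then have "m \<noteq> ?y"
    using argmin_stationary[OF k(1)] s by auto
  then show "0 < excess k m ?y"
    using m k(1) by (intro excess_argmin_pos) auto
  have le: "excess k m ?y \<le> (?y - m) * s / 2"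
    using excess_le[of m ?y k] slope y m by auto
  have "excess k m ?y \<le> 1 / 12"
  \<comment> \<open>The bounds \<open>k / 2\<close> and \<open>1 / 2\<close> on the minimiser
    coincide at \<open>m = 1 / 4\<close>, so each case uses the smaller one.\<close>
  proof (cases "m \<le> 1 / 4")
    case True
    have "?y - m \<le> 2 * m\<^sup>2 / (1 - 2 * m)"
      using y(3) m by (simp add: k_def field_simps power2_eq_square)
    then have "(?y - m) * s \<le> 2 * m\<^sup>2 / (1 - 2 * m) * s"
      using s by (intro mult_right_mono) auto
    also have "\<dots> = 2 * m\<^sup>2 / (1 - m)"
      using m by (simp add: s_def)
    also have "\<dots> \<le> 2 * (1 / 4)\<^sup>2 / (1 - 1 / 4)"
      using m True by (intro frac_le mult_left_mono power_mono) auto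
    finally show ?thesis
      using le by (simp add: power2_eq_square)
  next
    case False
    \<comment> \<open>The factor \<open>2 / 3\<close> is the value at \<open>m = 1 / 4\<close> of
      \<open>s\<close>, which decreases in \<open>m\<close>.\<close>
    have "(?y - m) * s \<le> (1 / 4) * (2 / 3)"
      using y(2) m False by (intro mult_mono) (auto simp: s_def field_simps)
    with le show ?thesis
      by simp
  qed
  \<comment> \<open>This puts the target bound above \<open>1 / 5\<close>, hence above
    \<open>1 / 12\<close>.\<close>
  moreover have "1.4 < sqrt (2::real)"
    by (rule real_less_rsqrt) (simp add: power2_eq_square)
  ultimately show "excess k m ?y < sqrt 2 / 2 - 1 / 2"
    by simp
qed

theorem theorem1:
  fixes \<mu> \<sigma> l :: real
  assumes "\<mu> < 1 / 2" and "\<sigma> > 0"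
    and "l = 2 * \<sigma>\<^sup>2 / (1 - 2 * \<mu>)"
  shows "\<exists>m \<in> {0<..<1}. m = (1 + l - sqrt (1 + l\<^sup>2)) / 2 \<and>
    (\<forall>x\<in>{0<..<1}. f1 \<mu> \<sigma> m \<le> f1 \<mu> \<sigma> x) \<and>
    (\<forall>\<^sub>F n in sequentially. m / real n \<in> {0<..<1} \<and>
       (\<exists>x\<^sub>0\<in>{0<..<1}. f2 n (m / real n) x\<^sub>0 = f2_min n (m / real n) \<and>
          (\<forall>x\<in>{0<..<1}. f2 n (m / real n) x\<^sub>0 \<le> f2 n (m / real n) x))) \<and>
    (\<exists>L. (\<lambda>n. f2 n (m / real n) m - f2_min n (m / real n)) \<longlonglongrightarrow> L \<and>
       0 < L \<and> L < sqrt 2 / 2 - 1 / 2)"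
proof -
  have l: "l > 0"
    using assms by simp
  define m where "m = argmin l"
  have m: "0 < m" "m < 1 / 2"
    using argmin_bounds[OF l] by (auto simp: m_def)
  have f1_min: "f1 \<mu> \<sigma> m \<le> f1 \<mu> \<sigma> x" if "x \<in> {0<..<1}" for x
    using KL_gaussian_argmin[OF assms(1) _ assms(3) that] assms(2) by (simp add: f1_def m_def)
  define v where "v n = m * (1 - m / real n)" for n
  define k where "k n = 2 * v n / (1 - 2 * m)" for n
  define x where "x n = argmin (k n)" for n
  \<comment> \<open>The mean \<open>n * (m / n)\<close> equals \<open>m\<close> only for positive
    \<open>n\<close>, since division by zero yields 0.\<close>
  have f2_eq: "f2 n (m / real n) z = KL (gaussian z (z * (1 - z))) (gaussian m (v n))"
    if "n > 0" for n z
    using that by (simp add: f2_def v_def)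
  have lam: "m / real n \<in> {0<..<1}" and v: "v n > 0" if "n > 0" for n
  proof -
    have "m < real n"
      using m(2) that by simp
    then show "m / real n \<in> {0<..<1}"
      using m(1) that by simp
    then show "v n > 0"
      using m(1) by (simp add: v_def)
  qed
  have x: "x n \<in> {0<..<1}" if "n > 0" for n
    using argmin_bounds[of "k n"] v[OF that] m by (simp add: x_def k_def)
  have f2_le: "f2 n (m / real n) (x n) \<le> f2 n (m / real n) z" if "n > 0" "z \<in> {0<..<1}" for n z
    unfolding f2_eq[OF that(1)] x_def
    using m v[OF that(1)] that(2) by (intro KL_gaussian_argmin) (auto simp: k_def)
  have f2_min_eq: "f2_min n (m / real n) = f2 n (m / real n) (x n)" if "n > 0" for n
    unfolding f2_min_def using x[OF that] f2_le[OF that]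
    by (intro cInf_eq_minimum) auto
  have gap: "f2 n (m / real n) m - f2_min n (m / real n) = excess (k n) m (x n)" if "n > 0" for n
    unfolding f2_min_eq[OF that] f2_eq[OF that]
    using m v[OF that] x[OF that] by (intro KL_gaussian_diff) (auto simp: k_def)
  define K where "K = 2 * m / (1 - 2 * m)"
  have K: "K > 0"
    using m by (simp add: K_def)
  have "(\<lambda>n. 2 * (m * (1 - m / real n)) / (1 - 2 * m)) \<longlonglongrightarrow> 2 * (m * (1 - 0)) / (1 - 2 * m)"
    using m by (intro tendsto_intros lim_const_over_n) auto
  then have k_lim: "k \<longlonglongrightarrow> K"
    by (simp add: k_def[abs_def] v_def K_def)
  then have x_lim: "x \<longlonglongrightarrow> argmin K"
    unfolding x_def argmin_def by (intro tendsto_intros) auto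
  \<comment> \<open>The limit \<open>argmin K\<close> lies strictly between 0 and 1 and
    \<open>K\<close> is nonzero, so \<open>excess\<close> is continuous there.\<close>
  have "(\<lambda>n. excess (k n) m (x n)) \<longlonglongrightarrow> excess K m (argmin K)"
    unfolding excess_def using m K argmin_bounds[OF K]
    by (intro tendsto_intros k_lim x_lim) auto
  moreover have "\<forall>\<^sub>F n in sequentially. excess (k n) m (x n) = f2 n (m / real n) m - f2_min n (m / real n)"
    using eventually_gt_at_top[of 0] by eventually_elim (simp add: gap)
  ultimately have gap_lim:
    "(\<lambda>n. f2 n (m / real n) m - f2_min n (m / real n)) \<longlonglongrightarrow> excess K m (argmin K)"
    by (rule Lim_transform_eventually)
  have "\<forall>\<^sub>F n in sequentially. m / real n \<in> {0<..<1} \<and>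
       (\<exists>x\<^sub>0\<in>{0<..<1}. f2 n (m / real n) x\<^sub>0 = f2_min n (m / real n) \<and>
          (\<forall>x\<in>{0<..<1}. f2 n (m / real n) x\<^sub>0 \<le> f2 n (m / real n) x))"
    using eventually_gt_at_top[of 0]
  proof eventually_elim
    case (elim n)
    then show ?case
      using lam x f2_min_eq f2_le by (metis (no_types, lifting))
  qed
  moreover have "m \<in> {0<..<1}" "m = (1 + l - sqrt (1 + l\<^sup>2)) / 2"
    using m by (auto simp: m_def argmin_def)
  ultimately show ?thesis
    using f1_min gap_lim excess_limit_bounds[OF m, folded K_def] by blast
qed

end
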